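(* Let $\lambda$ be a nonzero real number. For all integers $m,n\ge 0$, $$\mathrm{Bel}_{n+m,\lambda}(t)=\sum_{k=0}^{m}\sum_{l=0}^{n}(1)_{k,\lambda}{m \brace k}_{\lambda}\binom{n}{l}t^{k}\,F_{n-l,\lambda}^{(k)}(-\lambda t,k-m\lambda)\,\mathrm{Bel}_{l,\lambda}(t).$$
   Context: For nonzero real $\lambda$, the degenerate falling factorial is $(x)_{0,\lambda}=1$, $(x)_{n,\lambda}=x(x-\lambda)\cdots(x-(n-1)\lambda)$ for $n\ge1$, and the degenerate exponential is $e_{\lambda}^{x}(t)=(1+\lambda t)^{x/\lambda}=\sum_{k\ge0}(x)_{k,\lambda}\frac{t^k}{k!}$, with $e_\lambda(t)=e_\lambda^1(t)$. The degenerate Stirling numbers of the second kind ${n \brace k}_{\lambda}$ are defined by $\frac{1}{k!}(e_{\lambda}(t)-1)^{k}=\sum_{n\ge k}{n \brace k}_{\lambda}\frac{t^{n}}{n!}$ for $k\ge0$. The fully degenerate Bell polynomials are $\mathrm{Bel}_{n,\lambda}(x)=\sum_{k=0}^{n}{n \brace k}_{\lambda}(1)_{k,\lambda}x^{k}$, equivalently $e_{\lambda}\big(x(e_{\lambda}(s)-1)\big)=\sum_{n\ge0}\mathrm{Bel}_{n,\lambda}(x)\frac{s^n}{n!}$. The two-variable degenerate Fubini polynomials of order $\alpha$ are defined by $\Big(\frac{1}{1-x(e_{\lambda}(s)-1)}\Big)^{\alpha}e_{\lambda}^{y}(s)=\sum_{n\ge0}F_{n,\lambda}^{(\alpha)}(x,y)\frac{s^{n}}{n!}$.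 *)

theory Defs
  imports "HOL-Computational_Algebra.Formal_Power_Series"
begin

definition deg_falling :: "real \<Rightarrow> real \<Rightarrow> nat \<Rightarrow> real" where
  "deg_falling lam x n = (\<Prod>i<n. x - real i * lam)"

text \<open>Generating functions are formal power series over the reals. The formal series of
  \<open>(1 + lam t)\<^bsup>x/lam\<^esup>\<close> is the binomial series at \<open>lam t\<close>, see \<open>deg_exp_eq_binomial\<close>.\<close>

definition deg_exp :: "real \<Rightarrow> real \<Rightarrow> real fps" where
  "deg_exp lam x = Abs_fps (\<lambda>k. deg_falling lam x k / fact k)"

definition deg_stirling2 :: "real \<Rightarrow> nat \<Rightarrow> nat \<Rightarrow> real" where
  "deg_stirling2 lam n k =
     fact n * fps_nth (fps_const (1 / fact k) * (deg_exp lam 1 - 1) ^ k) n"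

definition deg_bell :: "real \<Rightarrow> nat \<Rightarrow> real \<Rightarrow> real" where
  "deg_bell lam n x = (\<Sum>k=0..n. deg_stirling2 lam n k * deg_falling lam 1 k * x ^ k)"

text \<open>Real power of a formal power series with constant term 1, as \<open>(1 + (f - 1))\<^bsup>a\<^esup>\<close>.\<close>

definition fps_real_power :: "real fps \<Rightarrow> real \<Rightarrow> real fps" where
  "fps_real_power f a = fps_compose (fps_binomial a) (f - 1)"

definition deg_fubini :: "real \<Rightarrow> real \<Rightarrow> nat \<Rightarrow> real \<Rightarrow> real \<Rightarrow> real" where
  "deg_fubini lam \<alpha> n x y =
     fact n * fps_nth
       (fps_real_power (1 / (1 - fps_const x * (deg_exp lam 1 - 1))) \<alpha> * deg_exp lam y) n"

lemma deg_exp_nth_0 [simp]: "fps_nth (deg_exp lam x) 0 = 1"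
  by (simp add: deg_exp_def deg_falling_def)

lemma deg_exp_eq_binomial:
  assumes "lam \<noteq> 0"
  shows "deg_exp lam x = fps_compose (fps_binomial (x / lam)) (fps_const lam * fps_X)"
proof (rule fps_ext)
  fix n
  have "deg_falling lam x n = lam ^ n * (\<Prod>i<n. x / lam - real i)"
    using assms by (induction n) (auto simp: deg_falling_def field_simps)
  then show "fps_nth (deg_exp lam x) n =
      fps_nth (fps_compose (fps_binomial (x / lam)) (fps_const lam * fps_X)) n"
    by (simp add: deg_exp_def gbinomial_prod_rev fps_compose_linear atLeast0LessThan)
qed

lemma deg_stirling2_eq_0: "n < k \<Longrightarrow> deg_stirling2 lam n k = 0"
  by (simp add: deg_stirling2_def startsby_zero_power_prefix)

lemma deg_bell_generating_function:
  "fps_compose (deg_exp lam 1) (fps_const x * (deg_exp lam 1 - 1)) =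
     Abs_fps (\<lambda>n. deg_bell lam n x / fact n)"
proof (rule fps_ext)
  fix n
  show "fps_nth (fps_compose (deg_exp lam 1) (fps_const x * (deg_exp lam 1 - 1))) n =
      fps_nth (Abs_fps (\<lambda>n. deg_bell lam n x / fact n)) n"
    unfolding fps_compose_nth deg_bell_def
    by (auto simp: sum_divide_distrib deg_stirling2_def power_mult_distrib fps_const_power
          deg_exp_def[of lam 1] intro!: sum.cong)
qed

lemma fps_real_power_of_nat:
  assumes "fps_nth f 0 = 1"
  shows "fps_real_power f (real k) = f ^ k"
  using assms
  by (simp add: fps_real_power_def fps_binomial_of_nat fps_compose_power [symmetric]
        fps_compose_add_distrib)

lemma deg_fubini_of_nat:
  "deg_fubini lam (real k) n x y =
     fact n * fps_nth ((1 / (1 - fps_const x * (deg_exp lam 1 - 1))) ^ k * deg_exp lam y) n"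
  by (simp add: deg_fubini_def fps_real_power_of_nat fps_divide_unit)

end

theory Submission
  imports Defs
begin

text \<open>Let \<open>B(s) = e\<^sub>\<lambda>(t(e\<^sub>\<lambda>(s) - 1))\<close> be the exponential generating function of the Bell
  polynomials and \<open>W = 1 + \<lambda>t(e\<^sub>\<lambda>(s) - 1)\<close>. Since \<open>e\<^sub>\<lambda>\<close> solves \<open>(1 + \<lambda>s) y' = y\<close>, one has
  \<open>B' = t W\<^sup>-\<^sup>1 e\<^sub>\<lambda>\<^bsup>1-\<lambda>\<^esup> B\<close>. Together with the recurrence
  \<open>S(m+1,k) = S(m,k-1) + (k - m\<lambda>) S(m,k)\<close> of the degenerate Stirling numbers, induction on \<open>m\<close> yields
  \<open>B\<^bsup>(m)\<^esup> = (\<Sum>k\<le>m. (1)\<^bsub>k,\<lambda>\<^esub> S(m,k) t\<^sup>k W\<^bsup>-k\<^esup> e\<^sub>\<lambda>\<^bsup>k-m\<lambda>\<^esup>) B\<close>, and \<open>W\<^bsup>-k\<^esup> e\<^sub>\<lambda>\<^bsup>k-m\<lambda>\<^esup>\<close> is the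
  generating function of the Fubini polynomials in question. It remains to compare coefficients.\<close>

unbundle fps_syntax

lemma deg_falling_0 [simp]: "deg_falling lam x 0 = 1"
  by (simp add: deg_falling_def)

lemma deg_falling_Suc: "deg_falling lam x (Suc k) = (x - real k * lam) * deg_falling lam x k"
  by (simp add: deg_falling_def)

lemma deg_falling_Suc_shift: "deg_falling lam x (Suc k) = x * deg_falling lam (x - lam) k"
  by (simp add: deg_falling_def prod.lessThan_Suc_shift algebra_simps del: prod.lessThan_Suc)

lemma deg_exp_0: "deg_exp lam 0 = 1"
proof (rule fps_ext)
  fix n
  show "deg_exp lam 0 $ n = 1 $ n"
    by (cases n) (simp_all add: deg_exp_def deg_falling_Suc_shift)
qed

lemma deg_exp_add:
  assumes "lam \<noteq> 0"
  shows "deg_exp lam (x + y) = deg_exp lam x * deg_exp lam y"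
  by (simp add: assms deg_exp_eq_binomial add_divide_distrib fps_binomial_add_mult
      fps_compose_mult_distrib)

lemma fps_deriv_deg_exp: "fps_deriv (deg_exp lam x) = fps_const x * deg_exp lam (x - lam)"
proof (rule fps_ext)
  fix n
  show "fps_deriv (deg_exp lam x) $ n = (fps_const x * deg_exp lam (x - lam)) $ n"
    by (simp add: deg_exp_def deg_falling_Suc_shift del: of_nat_Suc)
qed

text \<open>Comparing coefficients, this is \<open>deg_falling_Suc\<close>. Unlike
  \<open>fps_deriv_deg_exp\<close>, it keeps the exponent \<open>x\<close>, so after composition the
  same composed series reappears on the right.\<close>

lemma deg_exp_ode:
  "(1 + fps_const lam * fps_X) * fps_deriv (deg_exp lam x) = fps_const x * deg_exp lam x"
proof (rule fps_ext)
  fix n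
  have "((1 + fps_const lam * fps_X) * fps_deriv (deg_exp lam x)) $ n
      = fps_deriv (deg_exp lam x) $ n + real n * lam * deg_exp lam x $ n"
    by (cases n) (simp_all add: distrib_right mult.assoc, simp add: algebra_simps)
  also have "fps_deriv (deg_exp lam x) $ n = (x - real n * lam) * deg_exp lam x $ n"
    by (simp add: deg_exp_def deg_falling_Suc del: of_nat_Suc)
  finally show "((1 + fps_const lam * fps_X) * fps_deriv (deg_exp lam x)) $ n
      = (fps_const x * deg_exp lam x) $ n"
    by (simp add: algebra_simps)
qed

lemma deg_stirling2_0_left: "deg_stirling2 lam 0 k = (if k = 0 then 1 else 0)"
  by (simp add: deg_stirling2_def fps_nth_power_0)

text \<open>Both sides are 0; the right side is shaped as the case \<open>k = 0\<close> of the
  general recurrence.\<close>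

lemma deg_stirling2_Suc_0: "deg_stirling2 lam (Suc m) 0 = - real m * lam * deg_stirling2 lam m 0"
  by (cases m) (simp_all add: deg_stirling2_def)

lemma deg_stirling2_Suc_Suc:
  "deg_stirling2 lam (Suc m) (Suc k) =
     deg_stirling2 lam m k + (real (Suc k) - real m * lam) * deg_stirling2 lam m (Suc k)"
proof -
  define f where "f k = fps_const (1 / fact k) * (deg_exp lam 1 - 1) ^ k" for k
  have S: "deg_stirling2 lam m k = fact m * f k $ m" for m k
    by (simp add: deg_stirling2_def f_def)
  have c: "fps_const (1 / fact (Suc k)) * of_nat (Suc k) = fps_const (1 / fact k :: real)"
    by (simp add: fps_of_nat [symmetric] del: of_nat_Suc)
  have d: "fps_deriv (f (Suc k)) = f k * fps_deriv (deg_exp lam 1)"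
    by (simp add: f_def fps_deriv_power' c [symmetric] mult_ac del: of_nat_Suc fact_Suc power_Suc)
  \<comment> \<open>Write \<open>deg_exp lam 1\<close> as 1 plus \<open>deg_exp lam 1 - 1\<close>;
    the second summand raises the power in \<open>f k\<close>.\<close>
  have e: "f k * deg_exp lam 1 = f k + of_nat (Suc k) * f (Suc k)"
    by (simp add: f_def c [symmetric] algebra_simps del: of_nat_Suc fact_Suc)
  have "(1 + fps_const lam * fps_X) * fps_deriv (f (Suc k)) = f k + of_nat (Suc k) * f (Suc k)"
    unfolding d e [symmetric] using deg_exp_ode[of lam 1] by (simp add: mult.left_commute)
  then have "((1 + fps_const lam * fps_X) * fps_deriv (f (Suc k))) $ m
      = (f k + fps_const (real (Suc k)) * f (Suc k)) $ m"
    by (simp only: fps_of_nat)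
  then have "real (Suc m) * f (Suc k) $ Suc m + lam * real m * f (Suc k) $ m
      = f k $ m + real (Suc k) * f (Suc k) $ m"
    by (cases m) (simp_all add: distrib_right mult.assoc del: of_nat_Suc)
  then have "fact m * (real (Suc m) * f (Suc k) $ Suc m)
      = fact m * (f k $ m + real (Suc k) * f (Suc k) $ m - lam * real m * f (Suc k) $ m)"
    by simp
  then show ?thesis
    by (simp add: S algebra_simps)
qed

context
  fixes lam t :: real
begin

definition bell_egf :: "real fps" where
  "bell_egf = deg_exp lam 1 oo (fps_const t * (deg_exp lam 1 - 1))"

text \<open>This is the base of the Fubini generating function at
  \<open>x = - lam * t\<close>.\<close>

definition fubini_base :: "real fps" where
  "fubini_base = inverse (1 + fps_const (lam * t) * (deg_exp lam 1 - 1))"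

lemma fubini_base_inverse:
  "fubini_base * (1 + fps_const (lam * t) * (deg_exp lam 1 - 1)) = 1"
  unfolding fubini_base_def by (rule inverse_mult_eq_1) simp

lemma fps_deriv_bell_egf:
  "fps_deriv bell_egf = fps_const t * fubini_base * deg_exp lam (1 - lam) * bell_egf"
proof -
  define u where "u = fps_const t * (deg_exp lam 1 - 1)"
  define W where "W = 1 + fps_const (lam * t) * (deg_exp lam 1 - 1)"
  have u0: "u $ 0 = 0" by (simp add: u_def)
  have "((1 + fps_const lam * fps_X) * fps_deriv (deg_exp lam 1)) oo u = deg_exp lam 1 oo u"
    by (simp add: deg_exp_ode)
  \<comment> \<open>Substituting \<open>u\<close> into the differential equation of
    \<open>deg_exp lam 1\<close> turns its left-hand coefficient into \<open>W\<close>.\<close>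
  moreover have "(1 + fps_const lam * fps_X) oo u = W"
    using u0 by (simp add: fps_compose_add_distrib fps_compose_mult_distrib W_def u_def
        flip: fps_const_mult)
  ultimately have *: "W * (fps_deriv (deg_exp lam 1) oo u) = bell_egf"
    using u0 by (simp add: fps_compose_mult_distrib bell_egf_def u_def)
  have "fps_deriv (deg_exp lam 1) oo u = fubini_base * W * (fps_deriv (deg_exp lam 1) oo u)"
    by (simp add: W_def fubini_base_inverse)
  also have "\<dots> = fubini_base * bell_egf"
    by (simp only: mult.assoc *)
  finally have **: "fps_deriv (deg_exp lam 1) oo u = fubini_base * bell_egf" .
  have "fps_deriv bell_egf = (fps_deriv (deg_exp lam 1) oo u) * fps_deriv u"
    unfolding bell_egf_def u_def by (rule fps_compose_deriv) simp
  also have "fps_deriv u = fps_const t * deg_exp lam (1 - lam)"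
    by (simp add: u_def fps_deriv_deg_exp)
  finally show ?thesis
    by (simp add: ** mult_ac)
qed

lemma fps_deriv_fubini_base:
  "fps_deriv fubini_base = - fps_const (lam * t) * deg_exp lam (1 - lam) * fubini_base ^ 2"
  unfolding fubini_base_def by (subst fps_inverse_deriv) (simp_all add: fps_deriv_deg_exp del: fps_const_neg)

text \<open>The Stirling number is left out, so that differentiation gives a two-term rule dual to
  the Stirling recurrence.\<close>

definition bell_term :: "nat \<Rightarrow> nat \<Rightarrow> real fps" where
  "bell_term m k = fps_const (deg_falling lam 1 k * t ^ k) * fubini_base ^ k
     * deg_exp lam (real k - real m * lam) * bell_egf"

text \<open>Differentiating \<open>fubini_base ^ k\<close> or \<open>bell_egf\<close> adds one
  factor \<open>fubini_base\<close> and one factor \<open>deg_exp lam (1 - lam)\<close>; together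
  they give the term with \<open>Suc k\<close>. Differentiating the exponential only lowers its
  exponent by \<open>lam\<close>, which gives the term with \<open>k\<close>.\<close>

lemma fps_deriv_bell_term:
  assumes lam: "lam \<noteq> 0"
  shows "fps_deriv (bell_term m k) =
     bell_term (Suc m) (Suc k) + fps_const (real k - real m * lam) * bell_term (Suc m) k"
proof -
  define c where "c = fps_const (deg_falling lam 1 k * t ^ k)"
  define V where "V = fubini_base"
  define B where "B = bell_egf"
  define D where "D = deg_exp lam (1 - lam)"
  define E where "E = deg_exp lam (real k - real m * lam)"
  define E' where "E' = deg_exp lam (real k - real (Suc m) * lam)"
  define a where "a = fps_const (real k - real m * lam)"
  have dV: "fps_deriv (V ^ k) = - fps_const (real k * (lam * t)) * D * V ^ Suc k"
  proof (cases k)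
    case (Suc j)
    have "fps_deriv (V ^ k) = fps_const (real k) * fps_deriv V * V ^ j"
      unfolding Suc fps_deriv_power by simp
    also have "\<dots> = - (fps_const (real k) * fps_const (lam * t)) * D * V ^ Suc k"
      by (simp add: V_def D_def Suc fps_deriv_fubini_base power2_eq_square mult_ac
          del: of_nat_Suc fps_const_mult fps_const_neg)
    finally show ?thesis by simp
  qed simp
  have dE: "fps_deriv E = a * E'"
    by (simp add: E_def E'_def a_def fps_deriv_deg_exp algebra_simps)
  have dB: "fps_deriv B = fps_const t * V * D * B"
    by (simp add: B_def V_def D_def fps_deriv_bell_egf)
  have ED: "deg_exp lam (real (Suc k) - real (Suc m) * lam) = E * D"
    unfolding E_def D_def deg_exp_add [OF lam, symmetric] by (simp add: algebra_simps)
  \<comment> \<open>The new factor of the falling factorial, times \<open>t\<close>, splits into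
    \<open>t\<close> from the derivative of \<open>B\<close> and \<open>- k * lam * t\<close> from
    that of \<open>V ^ k\<close>.\<close>
  have "fps_const (deg_falling lam 1 (Suc k) * t ^ Suc k)
      = fps_const (1 - real k * lam) * fps_const t * c"
    by (simp add: c_def deg_falling_Suc mult_ac)
  also have "\<dots> = (fps_const t - fps_const (real k * (lam * t))) * c"
    by (simp add: algebra_simps)
  finally have coeff: "fps_const (deg_falling lam 1 (Suc k) * t ^ Suc k)
      = (fps_const t - fps_const (real k * (lam * t))) * c" .
  have "fps_deriv (bell_term m k) = fps_deriv (c * V ^ k * E * B)"
    by (simp add: bell_term_def c_def V_def E_def B_def)
  also have "\<dots> = c * (fps_deriv (V ^ k) * E * B + V ^ k * fps_deriv E * B
      + V ^ k * E * fps_deriv B)"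
    by (simp add: c_def algebra_simps del: fps_const_mult)
  also have "\<dots> = (fps_const t - fps_const (real k * (lam * t))) * c * V ^ Suc k * (E * D) * B
      + a * (c * V ^ k * E' * B)"
    unfolding dV dE dB by (simp add: algebra_simps del: fps_const_mult fps_const_sub fps_const_neg)
  also have "\<dots> = bell_term (Suc m) (Suc k) + a * bell_term (Suc m) k"
    unfolding bell_term_def coeff ED by (simp add: c_def V_def E'_def B_def)
  finally show ?thesis by (simp add: a_def)
qed

lemma bell_egf_shift:
  assumes lam: "lam \<noteq> 0"
  shows "Abs_fps (\<lambda>n. deg_bell lam (n + m) t / fact n)
     = (\<Sum>k\<le>m. fps_const (deg_stirling2 lam m k) * bell_term m k)"
proof (induction m)
  case 0
  show ?case
    by (simp add: bell_term_def deg_falling_def deg_stirling2_0_left bell_egf_def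
        deg_bell_generating_function deg_exp_0)
next
  case (Suc m)
  define S where "S m k = fps_const (deg_stirling2 lam m k)" for m k
  define a where "a k = fps_const (real k - real m * lam)" for k
  let ?T = "bell_term (Suc m)"
  have S0: "S (Suc m) 0 = a 0 * S m 0"
    by (simp add: S_def a_def deg_stirling2_Suc_0)
  have SS: "S (Suc m) (Suc k) = S m k + a (Suc k) * S m (Suc k)" for k
    by (simp add: S_def a_def deg_stirling2_Suc_Suc)
  have top: "S m (Suc m) = 0"
    by (simp add: S_def deg_stirling2_eq_0)
  have "Abs_fps (\<lambda>n. deg_bell lam (n + Suc m) t / fact n)
      = fps_deriv (Abs_fps (\<lambda>n. deg_bell lam (n + m) t / fact n))"
    by (rule fps_ext) (simp del: of_nat_Suc)
  also have "\<dots> = (\<Sum>k\<le>m. S m k * (?T (Suc k) + a k * ?T k))"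
    by (simp add: Suc.IH fps_deriv_sum fps_deriv_bell_term [OF lam] S_def a_def)
  \<comment> \<open>By \<open>top\<close> the second sum may run to \<open>Suc m\<close>; splitting
    off its term at 0 then aligns it with the first, and \<open>SS\<close> merges the two.\<close>
  also have "\<dots> = (\<Sum>k\<le>m. S m k * ?T (Suc k)) + (\<Sum>k\<le>Suc m. a k * S m k * ?T k)"
    by (simp add: sum.distrib algebra_simps top)
  also have "\<dots> = (\<Sum>k\<le>Suc m. S (Suc m) k * ?T k)"
    unfolding sum.atMost_Suc_shift S0 SS by (simp add: distrib_right sum.distrib)
  finally show ?case by (simp only: S_def)
qed

end

theorem theorem2:
  fixes lam t :: real and m n :: nat
  assumes "lam \<noteq> 0"
  shows "deg_bell lam (n + m) t =
    (\<Sum>k=0..m. \<Sum>l=0..n. deg_falling lam 1 k * deg_stirling2 lam m k * real (n choose l) * t ^ k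
        * deg_fubini lam (real k) (n - l) (- lam * t) (real k - real m * lam)
        * deg_bell lam l t)"
proof -
  define F where "F k j = deg_fubini lam (real k) j (- lam * t) (real k - real m * lam)" for k j
  have fub: "(fubini_base lam t ^ k * deg_exp lam (real k - real m * lam)) $ j = F k j / fact j"
    for k j
    by (simp add: F_def deg_fubini_of_nat fubini_base_def fps_divide_unit flip: fps_const_neg)
  have bel: "bell_egf lam t $ l = deg_bell lam l t / fact l" for l
    by (simp add: bell_egf_def deg_bell_generating_function)
  \<comment> \<open>This turns a Cauchy product of exponential generating functions into a binomial
    convolution.\<close>
  have binom: "fact n * (x / fact l * (y / fact (n - l))) = real (n choose l) * y * x"
    if "l \<le> n" for l and x y :: real
    using that by (simp add: binomial_fact field_simps)
  \<comment> \<open>With \<open>bell_egf\<close> as first factor, the Cauchy product gives index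
    \<open>l\<close> to the Bell and \<open>n - l\<close> to the Fubini polynomials.\<close>
  have term_eq: "bell_term lam t m k = fps_const (deg_falling lam 1 k * t ^ k) *
      (bell_egf lam t * (fubini_base lam t ^ k * deg_exp lam (real k - real m * lam)))" for k
    by (simp add: bell_term_def mult_ac)
  have "deg_bell lam (n + m) t = fact n * Abs_fps (\<lambda>n. deg_bell lam (n + m) t / fact n) $ n"
    by simp
  also have "\<dots> = (\<Sum>k\<le>m. deg_stirling2 lam m k * (deg_falling lam 1 k * t ^ k) * (fact n *
      (bell_egf lam t * (fubini_base lam t ^ k * deg_exp lam (real k - real m * lam))) $ n))"
    unfolding bell_egf_shift [OF assms]
    by (simp add: term_eq fps_sum_nth sum_distrib_left mult.assoc
        mult.left_commute [of "fact n"])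
  also have "\<dots> = (\<Sum>k\<le>m. deg_stirling2 lam m k * (deg_falling lam 1 k * t ^ k) *
      (\<Sum>l=0..n. real (n choose l) * F k (n - l) * deg_bell lam l t))"
    unfolding fps_mult_nth [of "bell_egf lam t"] fub bel sum_distrib_left [of "fact n"]
    by (intro sum.cong arg_cong2 [where f = "(*)"] refl binom) simp
  finally show ?thesis
    by (simp add: F_def sum_distrib_left mult_ac atLeast0AtMost)
qed

end
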